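(* Let $A$ be a (finite or countably infinite) alphabet, let $\mu$ be a probability distribution on $A$, and let $n>1$ be an integer. Let $x^*=x_1x_2\dots$ be a sequence of i.i.d. random variables with distribution $\mu$ on $A$ (the covertext), and let $y^*=y_1y_2\dots$ be a sequence of i.i.d. random variables uniform on $\{0,1\}$ (the hidden text), independent of $x^*$. Let $X=X_1X_2\dots$ be the sequence output by the stegosystem $St_n(A)$ applied to $x^*$ and $y^*$. Then: (i) $X$ obeys the same distribution as the input sequence, i.e. $X_1,X_2,\dots$ are i.i.d. with distribution $\mu$; (ii) the average number $L_n$ of secret symbols per covertext letter satisfies $$L_n\ \ge\ \frac1n\left(\sum_{u\in A^n}\mu(u)\,\log\frac{n!}{\prod_{a\in A}\nu_u(a)!}\;-\;2\right),$$ where $\mu(u)=\prod_{j=1}^n\mu(u_j)$ is the $\mu$-probability of the word $u=u_1\dots u_n$ and $\nu_u(a)$ is the number of occurrences of the letter $a$ in the word $u$.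
   Context: All logarithms are to base $2$. For a word $u\in A^n$ and $a\in A$ let $\nu_u(a)$ be the number of occurrences of $a$ in $u$, and let $$S_u=\{v\in A^n:\ \forall a\in A\ \ \nu_v(a)=\nu_u(a)\}.$$ For each such (finite) set fix an enumeration $S_u=\{s_0,s_1,\dots,s_{|S_u|-1}\}$ (for example lexicographical) depending only on the set $S_u$. Put $m=\lfloor\log_2|S_u|\rfloor$ and write the binary expansion $|S_u|=\sum_{i=0}^m\alpha_i2^i$ with $\alpha_i\in\{0,1\}$, $\alpha_m=1$. The stegosystem $St_n(A)$: the sequence $x^*$ is split into consecutive blocks of length $n$, which are processed in order. For a block $u$, a value $d$ of a random variable $\Delta$ is generated, where $$p(\Delta=i)=\frac{\alpha_i2^i}{|S_u|},\qquad i\in\{0,1,\dots,m\};$$ given the blocks, the values of $\Delta$ for different blocks are generated independently of each other and of $y^*$. Then the next $d$ not yet used symbols of $y^*$ are read (and used up); regarded as a binary representation of length $d$, they give an integer $r\in\{0,\dots,2^d-1\}$ (with $r=0$ if $d=0$). The corresponding output block of length $n$ is $s_\tau\in S_u$, where $$\tau=\sum_{l=d+1}^m\alpha_l2^l+r.$$ The output sequence $X$ is the concatenation of the output blocks. The average number of secret symbols per covertext letter, $L_n$, is the expected number of symbols of $y^*$ used up in the processing of one block, divided by $n$. *)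

theory Defs
  imports "HOL-Probability.Probability"
begin

definition iid :: "'w measure \<Rightarrow> (nat \<Rightarrow> 'w \<Rightarrow> 'b) \<Rightarrow> 'b pmf \<Rightarrow> bool" where
  "iid M Z p \<longleftrightarrow>
     prob_space.indep_vars M (\<lambda>_. count_space UNIV) Z UNIV \<and>
     (\<forall>i. distr M (count_space UNIV) (Z i) = measure_pmf p)"

(* The two sequences may take values in different types, so prob_space.indep_var (which needs
   a common type) is replaced by independence of the generated sigma-algebras. *)
definition indep_sequences ::
    "'w measure \<Rightarrow> (nat \<Rightarrow> 'w \<Rightarrow> 'b) \<Rightarrow> (nat \<Rightarrow> 'w \<Rightarrow> 'c) \<Rightarrow> bool" where
  "indep_sequences M Y Z \<longleftrightarrow>
     prob_space.indep_set M
       (sets (vimage_algebra (space M) (\<lambda>\<omega> i. Y i \<omega>) (PiM UNIV (\<lambda>_. count_space UNIV))))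
       (sets (vimage_algebra (space M) (\<lambda>\<omega> i. Z i \<omega>) (PiM UNIV (\<lambda>_. count_space UNIV))))"

definition same_counts :: "'a list \<Rightarrow> 'a list set" where
  "same_counts u = {v. length v = length u \<and> (\<forall>a. count_list v a = count_list u a)}"

definition top_bit :: "'a list \<Rightarrow> nat" where
  "top_bit u = nat \<lfloor>log 2 (real (card (same_counts u)))\<rfloor>"

definition bin_digit :: "'a list \<Rightarrow> nat \<Rightarrow> nat" where
  "bin_digit u i = of_bool (bit (card (same_counts u)) i)"

definition delta_prob :: "'a list \<Rightarrow> nat \<Rightarrow> real" where
  "delta_prob u i =
     (if i \<le> top_bit u then real (bin_digit u i * 2 ^ i) / real (card (same_counts u)) else 0)"

(* Sequences are indexed from 0; block k consists of the positions k * n, ..., k * n + n - 1. *)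
definition block :: "nat \<Rightarrow> (nat \<Rightarrow> 'a) \<Rightarrow> nat \<Rightarrow> 'a list" where
  "block n x k = map (\<lambda>j. x (k * n + j)) [0..<n]"

(* d k is the number of secret symbols read for block k. *)
definition read_pos :: "(nat \<Rightarrow> nat) \<Rightarrow> nat \<Rightarrow> nat" where
  "read_pos d k = (\<Sum>j<k. d j)"

(* The secret bits (False = 0, True = 1) are read most significant bit first. *)
definition read_int :: "(nat \<Rightarrow> bool) \<Rightarrow> (nat \<Rightarrow> nat) \<Rightarrow> nat \<Rightarrow> nat" where
  "read_int y d k = (\<Sum>i<d k. of_bool (y (read_pos d k + i)) * 2 ^ (d k - 1 - i))"

definition out_block ::
    "('a list set \<Rightarrow> nat \<Rightarrow> 'a list) \<Rightarrow> nat \<Rightarrow> (nat \<Rightarrow> 'a) \<Rightarrow> (nat \<Rightarrow> bool) \<Rightarrow> (nat \<Rightarrow> nat) \<Rightarrow>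
     nat \<Rightarrow> 'a list" where
  "out_block s n x y d k =
     (let u = block n x k;
          \<tau> = (\<Sum>l = d k + 1..top_bit u. bin_digit u l * 2 ^ l) + read_int y d k
      in s (same_counts u) \<tau>)"

definition stego_out ::
    "('a list set \<Rightarrow> nat \<Rightarrow> 'a list) \<Rightarrow> nat \<Rightarrow> (nat \<Rightarrow> 'a) \<Rightarrow> (nat \<Rightarrow> bool) \<Rightarrow> (nat \<Rightarrow> nat) \<Rightarrow>
     nat \<Rightarrow> 'a" where
  "stego_out s n x y d j = out_block s n x y d (j div n) ! (j mod n)"

(* Given the blocks, the values D 0, D 1, ... are independent of each other and of the secret
   sequence, D k having law delta_prob (block k). Since blocks take countably many values, this is
   expressed by elementary conditioning on the first N blocks, for every N; letting N grow,
   this determines the joint law of the three sequences. *)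
definition block_choices ::
    "'w measure \<Rightarrow> nat \<Rightarrow> (nat \<Rightarrow> 'w \<Rightarrow> 'a) \<Rightarrow> (nat \<Rightarrow> 'w \<Rightarrow> bool) \<Rightarrow> (nat \<Rightarrow> 'w \<Rightarrow> nat) \<Rightarrow> bool" where
  "block_choices M n x y D \<longleftrightarrow>
     (\<forall>k. D k \<in> measurable M (count_space UNIV)) \<and>
     (\<forall>N us ds. \<forall>E \<in> sets (PiM UNIV (\<lambda>_. count_space UNIV)).
        \<P>(\<omega> in M. \<forall>k<N. block n (\<lambda>i. x i \<omega>) k = us k) > 0 \<longrightarrow>
        \<P>(\<omega> in M. (\<forall>k<N. D k \<omega> = ds k) \<and> (\<lambda>i. y i \<omega>) \<in> E
                  \<bar> \<forall>k<N. block n (\<lambda>i. x i \<omega>) k = us k)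
          = (\<Prod>k<N. delta_prob (us k) (ds k)) * \<P>(\<omega> in M. (\<lambda>i. y i \<omega>) \<in> E))"

(* The average L_n, computed from block k. Under block_choices, D k is almost surely at most
   log 2 (fact n), so the integral is a genuine expectation. *)
definition secret_rate :: "'w measure \<Rightarrow> nat \<Rightarrow> (nat \<Rightarrow> 'w \<Rightarrow> nat) \<Rightarrow> nat \<Rightarrow> real" where
  "secret_rate M n D k = (\<integral>\<omega>. real (D k \<omega>) \<partial>M) / real n"

end

theory Submission
  imports Defs "HOL-Combinatorics.Multiset_Permutations"
begin

text \<open>
  Fix a target word \<open>w\<close> in \<open>S\<^sub>u\<close>. The index of \<open>w\<close> lies in exactly one of the intervals of length
  \<open>2\<^sup>d\<close>, for \<open>d\<close> with \<open>\<alpha>\<^sub>d = 1\<close>, that partition \<open>{0..<|S\<^sub>u|}\<close>, so exactly one value \<open>d\<close> of \<open>\<Delta>\<close> and one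
  string of \<open>d\<close> secret bits turn \<open>u\<close> into \<open>w\<close>. This has probability \<open>(2\<^sup>d / |S\<^sub>u|) 2\<^sup>-\<^sup>d = 1 / |S\<^sub>u|\<close>, whatever
  \<open>d\<close> is: the output is uniform on \<open>S\<^sub>u\<close>. Since \<open>\<mu>\<close> is constant on \<open>S\<^sub>u\<close>, summing over the words
  \<open>u\<close> in \<open>S\<^sub>w\<close> gives probability \<open>\<mu>(w)\<close>. Different blocks read disjoint parts of the secret
  sequence, so the same computation applies to finite sequences of blocks.

  For the rate, \<open>E \<Delta>\<close> differs from \<open>log |S\<^sub>u|\<close> by at most 2, and \<open>|S\<^sub>u|\<close> is a multinomial
  coefficient.
\<close>

section \<open>Measurability over countable types; i.i.d. sequences from prefix
  probabilities\<close>

lemma measurable_countable2: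
  fixes f :: "'w \<Rightarrow> 'b::countable" and g :: "'w \<Rightarrow> 'c::countable"
  assumes f: "f \<in> measurable M (count_space UNIV)" and g: "g \<in> measurable M (count_space UNIV)"
  shows "(\<lambda>\<omega>. h (f \<omega>) (g \<omega>)) \<in> measurable M (count_space UNIV)"
  by (rule measurable_compose_countable[OF _ f], rule measurable_compose[OF g]) simp

lemma measurable_map_upt:
  fixes Z :: "nat \<Rightarrow> 'w \<Rightarrow> 'b::countable"
  assumes "\<And>j. Z j \<in> measurable M (count_space UNIV)"
  shows "(\<lambda>\<omega>. map (\<lambda>j. Z j \<omega>) [0..<L]) \<in> measurable M (count_space UNIV)"
proof (induction L)
  case (Suc L)
  then have "(\<lambda>\<omega>. map (\<lambda>j. Z j \<omega>) [0..<L] @ [Z L \<omega>]) \<in> measurable M (count_space UNIV)"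
    using assms by (rule measurable_countable2)
  then show ?case by simp
qed simp

text \<open>A lower bound on the probabilities of words suffices: both sides are probability mass
  functions on words of length \<open>L\<close>, so neither can be pointwise below the other without equality.\<close>

lemma measure_prefix_eq:
  fixes Z :: "nat \<Rightarrow> 'w \<Rightarrow> 'b::countable"
  assumes "prob_space M"
    and Z: "\<And>j. Z j \<in> measurable M (count_space UNIV)"
    and le: "\<And>a. (\<Prod>j<L. pmf p (a j)) \<le> measure M {\<omega> \<in> space M. \<forall>j<L. Z j \<omega> = a j}"
  shows "measure M {\<omega> \<in> space M. \<forall>j<L. Z j \<omega> \<in> A j} = (\<Prod>j<L. measure_pmf.prob p (A j))"
proof -
  interpret prob_space M by fact
  note Z[measurable]
  define V where "V = (\<lambda>\<omega>. map (\<lambda>j. Z j \<omega>) [0..<L])"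
  define W :: "(nat \<Rightarrow> 'b) \<Rightarrow> 'b list" where "W = (\<lambda>f. map f [0..<L])"
  have V_vimage: "V -` {xs. length xs = L \<and> (\<forall>j<L. xs ! j \<in> B j)} \<inter> space M
      = {\<omega> \<in> space M. \<forall>j<L. Z j \<omega> \<in> B j}" for B
    by (auto simp: V_def)
  have W_vimage: "W -` {xs. length xs = L \<and> (\<forall>j<L. xs ! j \<in> B j)} = Pi {..<L} B" for B
    by (auto simp: W_def Pi_def)
  have single: "{xs} = {ys. length ys = L \<and> (\<forall>j<L. ys ! j \<in> {xs ! j})}"
    if "length xs = L" for xs :: "'b list"
    using that by (auto intro: nth_equalityI)
  have V_eq: "V -` {xs} \<inter> space M = {\<omega> \<in> space M. \<forall>j<L. Z j \<omega> = xs ! j}"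
    if "length xs = L" for xs
    unfolding single[OF that] V_vimage by simp
  have V: "V \<in> measurable M (count_space UNIV)"
    unfolding V_def by (rule measurable_map_upt) (rule Z)
  interpret law: prob_space "distr M (count_space UNIV) V"
    using V by (rule prob_space_distr)
  \<comment> \<open>Words over a countable alphabet form a countable type, so the law of
    \<open>V\<close> is discrete and can be regarded as a pmf.\<close>
  define P where "P = Abs_pmf (distr M (count_space UNIV) V)"
  have P: "measure_pmf P = distr M (count_space UNIV) V"
    unfolding P_def
  proof (rule pmf.Abs_pmf_inverse, intro CollectI conjI)
    show "AE xs in distr M (count_space UNIV) V. measure (distr M (count_space UNIV) V) {xs} \<noteq> 0"
      by (subst law.AE_support_countable) (auto intro!: exI[of _ UNIV])
  qed (auto intro: law.prob_space_axioms)
  have prob_P: "measure_pmf.prob P B = prob (V -` B \<inter> space M)" for B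
    unfolding P by (rule measure_distr[OF V]) simp
  \<comment> \<open>The law to compare with. \<open>W\<close> reads only the first \<open>L\<close>
    coordinates, so the default value \<open>undefined\<close> of \<open>Pi_pmf\<close> never
    shows.\<close>
  define Q where "Q = map_pmf W (Pi_pmf {..<L} undefined (\<lambda>_. p))"
  have prob_Q: "measure_pmf.prob Q {xs. length xs = L \<and> (\<forall>j<L. xs ! j \<in> B j)}
      = (\<Prod>j<L. measure_pmf.prob p (B j))" for B
    unfolding Q_def measure_map_pmf W_vimage by (rule measure_Pi_pmf_Pi) simp
  have "pmf Q xs \<le> pmf P xs" for xs
  proof (cases "length xs = L")
    case True
    have "pmf Q xs = (\<Prod>j<L. pmf p (xs ! j))"
      using prob_Q[of "\<lambda>j. {xs ! j}"] unfolding single[OF True, symmetric]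
      by (simp add: measure_pmf_single)
    also have "\<dots> \<le> pmf P xs"
      using le[of "\<lambda>j. xs ! j"] V_eq[OF True] prob_P[of "{xs}"] by (simp add: measure_pmf_single)
    finally show ?thesis .
  next
    case False
    then have "xs \<notin> set_pmf Q" by (auto simp: Q_def W_def)
    then show ?thesis by (simp add: set_pmf_iff)
  qed
  \<comment> \<open>Distinct pmfs would leave a point where \<open>P\<close> has strictly less mass
    than \<open>Q\<close>.\<close>
  then have "P = Q" using pmf_neq_exists_less[of P Q] by (auto simp: not_less[symmetric])
  then show ?thesis
    using prob_Q[of A] prob_P[of "{xs. length xs = L \<and> (\<forall>j<L. xs ! j \<in> A j)}"] V_vimage[of A] by simp
qed

text \<open>Every finite index set fits into a prefix of length \<open>N * c\<close>, so these
  prefixes determine all finite-dimensional laws. Multiples of \<open>c\<close> suit an output that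
  arrives in whole blocks.\<close>

lemma iid_if_prefix_lower_bound:
  fixes Z :: "nat \<Rightarrow> 'w \<Rightarrow> 'b::countable"
  assumes "prob_space M" and "c > 0"
    and Z: "\<And>j. Z j \<in> measurable M (count_space UNIV)"
    and le: "\<And>N a. (\<Prod>j<N * c. pmf p (a j)) \<le> measure M {\<omega> \<in> space M. \<forall>j<N * c. Z j \<omega> = a j}"
  shows "iid M Z p"
proof -
  interpret prob_space M by fact
  have prefix: "prob {\<omega> \<in> space M. \<forall>j<N * c. Z j \<omega> \<in> A j} = (\<Prod>j<N * c. measure_pmf.prob p (A j))"
    for N A
    by (rule measure_prefix_eq[OF \<open>prob_space M\<close> Z le])
  have fin: "prob (\<Inter>j\<in>J. Z j -` A j \<inter> space M) = (\<Prod>j\<in>J. measure_pmf.prob p (A j))"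
    if J: "finite J" "J \<noteq> {}" for J A
  proof -
    define N where "N = Suc (Max J)"
    have "j < N * c" if "j \<in> J" for j
    proof -
      have "j < N" using that J by (simp add: N_def le_imp_less_Suc)
      also have "N \<le> N * c" using \<open>c > 0\<close> by simp
      finally show ?thesis .
    qed
    then have JN: "J \<subseteq> {..<N * c}" by auto
    \<comment> \<open>Indices outside \<open>J\<close> are left free and contribute a factor
      1.\<close>
    let ?A = "\<lambda>j. if j \<in> J then A j else UNIV"
    have "(\<Inter>j\<in>J. Z j -` A j \<inter> space M) = {\<omega> \<in> space M. \<forall>j<N * c. Z j \<omega> \<in> ?A j}"
      using JN J by auto
    also have "prob \<dots> = (\<Prod>j<N * c. measure_pmf.prob p (?A j))" by (rule prefix)
    also have "\<dots> = (\<Prod>j\<in>J. measure_pmf.prob p (?A j))"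
      using JN by (intro prod.mono_neutral_right) auto
    finally show ?thesis by simp
  qed
  have one: "prob (Z j -` A \<inter> space M) = measure_pmf.prob p A" for j A
    using fin[of "{j}" "\<lambda>_. A"] by simp
  have "indep_vars (\<lambda>_. count_space UNIV) Z UNIV"
    unfolding indep_vars_def2
  proof (intro conjI ballI)
    show "indep_sets (\<lambda>i. {Z i -` A \<inter> space M |A. A \<in> sets (count_space UNIV)}) UNIV"
    proof (rule indep_setsI)
      fix B J assume J: "J \<noteq> {}" "J \<subseteq> UNIV" "finite J"
        "\<forall>j\<in>J. B j \<in> {Z j -` A \<inter> space M |A. A \<in> sets (count_space UNIV)}"
      then obtain A where A: "\<And>j. j \<in> J \<Longrightarrow> B j = Z j -` A j \<inter> space M"
        by (simp add: bchoice_iff) metis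
      then have "prob (\<Inter>j\<in>J. B j) = prob (\<Inter>j\<in>J. Z j -` A j \<inter> space M)" by simp
      also have "\<dots> = (\<Prod>j\<in>J. prob (B j))"
        using fin[OF J(3,1), of A] one A by simp
      finally show "prob (\<Inter>j\<in>J. B j) = (\<Prod>j\<in>J. prob (B j))" .
    qed (auto intro: measurable_sets[OF Z])
  qed (rule Z)
  moreover have "distr M (count_space UNIV) (Z j) = measure_pmf p" for j
  proof (rule measure_eqI)
    fix A :: "'b set"
    show "emeasure (distr M (count_space UNIV) (Z j)) A = emeasure (measure_pmf p) A"
      using Z[of j] one[of j A]
      by (simp add: emeasure_distr emeasure_eq_measure measure_pmf.emeasure_eq_measure)
  qed simp
  ultimately show ?thesis by (simp add: iid_def)
qed

lemma iid_prefix: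
  assumes "prob_space M" and "iid M Z p"
  shows "measure M {\<omega> \<in> space M. \<forall>j<L. Z j \<omega> = a j} = (\<Prod>j<L. pmf p (a j))"
proof (cases "L = 0")
  \<comment> \<open>An intersection over no indices is \<open>UNIV\<close> rather than
    \<open>space M\<close>, so the empty prefix is treated apart.\<close>
  case True
  then show ?thesis using prob_space.prob_space[OF assms(1)] by simp
next
  case False
  interpret prob_space M by fact
  have ind: "indep_vars (\<lambda>_. count_space UNIV) Z UNIV"
    and Z: "\<And>j. distr M (count_space UNIV) (Z j) = measure_pmf p"
    using assms(2) by (auto simp: iid_def)
  then have [measurable]: "Z j \<in> measurable M (count_space UNIV)" for j
    by (auto simp: indep_vars_def)
  have "{\<omega> \<in> space M. \<forall>j<L. Z j \<omega> = a j} = (\<Inter>j<L. Z j -` {a j} \<inter> space M)"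
    using False by auto
  also have "prob \<dots> = (\<Prod>j<L. prob (Z j -` {a j} \<inter> space M))"
    using False by (intro indep_varsD[OF ind]) auto
  also have "\<dots> = (\<Prod>j<L. pmf p (a j))"
  proof (rule prod.cong[OF refl])
    fix j
    have "prob (Z j -` {a j} \<inter> space M) = measure (distr M (count_space UNIV) (Z j)) {a j}"
      by (rule measure_distr[symmetric]) auto
    then show "prob (Z j -` {a j} \<inter> space M) = pmf p (a j)"
      by (simp add: Z measure_pmf_single)
  qed
  finally show ?thesis .
qed

section \<open>Words with prescribed letter counts\<close>

text \<open>Equal letter counts mean equal multisets of letters; finiteness and cardinality then
  come from the theory of multiset permutations.\<close>

lemma same_counts_eq: "same_counts u = permutations_of_multiset (mset u)"
proof -
  have "mset v = mset u \<longleftrightarrow> length v = length u \<and> (\<forall>a. count_list v a = count_list u a)" for v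
    by (auto simp: multiset_eq_iff count_mset dest: mset_eq_length)
       (metis count_mset multiset_eqI size_mset)
  then show ?thesis by (auto simp: same_counts_def permutations_of_multiset_def)
qed

lemma finite_same_counts: "finite (same_counts u)"
  by (simp add: same_counts_eq)

lemma card_same_counts_pos: "card (same_counts u) > 0"
  by (simp add: same_counts_eq card_gt_0_iff)

lemma same_counts_cong: "v \<in> same_counts u \<Longrightarrow> same_counts v = same_counts u"
  by (auto simp: same_counts_def)

text \<open>The product depends only on the multiset of letters. With \<open>f = pmf \<mu>\<close>
  this makes \<mu> constant on \<open>S_u\<close>.\<close>

lemma prod_list_same_counts:
  fixes f :: "'a \<Rightarrow> 'b::comm_monoid_mult"
  assumes "v \<in> same_counts u"
  shows "prod_list (map f v) = prod_list (map f u)"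
proof -
  have "mset v = mset u" using assms by (simp add: same_counts_eq permutations_of_multiset_def)
  then have "mset (map f v) = mset (map f u)" by simp
  then show ?thesis by (metis prod_mset_prod_list)
qed

text \<open>The multinomial coefficient. The product may be restricted to \<open>set u\<close>,
  since absent letters contribute 0! = 1.\<close>

lemma real_card_same_counts:
  "real (card (same_counts u)) = fact (length u) / (\<Prod>a\<in>set u. fact (count_list u a))"
proof -
  have "card (same_counts u) * (\<Prod>a\<in>set u. fact (count_list u a)) = (fact (length u) :: nat)"
    using card_permutations_of_multiset_aux[of "mset u"] by (simp add: same_counts_eq count_mset)
  then have "real (card (same_counts u) * (\<Prod>a\<in>set u. fact (count_list u a))) = fact (length u)"
    by (metis of_nat_fact)
  then show ?thesis by (simp add: field_simps)
qed

section \<open>Binary expansion of |S_u| and the law of \<Delta>\<close>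

lemma power_top_bit:
  "2 ^ top_bit u \<le> card (same_counts u)" "card (same_counts u) < 2 ^ Suc (top_bit u)"
proof -
  define C where "C = card (same_counts u)"
  have C: "C > 0" by (simp add: C_def card_same_counts_pos)
  then have "0 \<le> log 2 (real C)" by simp
  then have m: "real (top_bit u) = of_int \<lfloor>log 2 (real C)\<rfloor>"
    unfolding top_bit_def C_def[symmetric] by simp
  have "2 powr real (top_bit u) \<le> real C"
    using C m by (simp flip: le_log_iff)
  then have "real (2 ^ top_bit u) \<le> real C" by (simp add: powr_realpow)
  then show "2 ^ top_bit u \<le> card (same_counts u)" unfolding C_def of_nat_le_iff .
  have "real C < 2 powr real (Suc (top_bit u))"
  proof -
    have "log 2 (real C) < real (Suc (top_bit u))" using m by linarith
    then show ?thesis using C by (simp add: log_less_iff)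
  qed
  then have "real C < real (2 ^ Suc (top_bit u))" by (subst (asm) powr_realpow) simp_all
  then show "card (same_counts u) < 2 ^ Suc (top_bit u)" unfolding C_def of_nat_less_iff .
qed

lemma sum_bits_eq:
  fixes c :: nat
  assumes "c < 2 ^ m"
  shows "(\<Sum>i<m. of_bool (bit c i) * 2 ^ i) = c"
proof -
  have "take_bit m c = (\<Sum>i<m. of_bool (bit c i) * 2 ^ i)"
    by (simp add: take_bit_sum push_bit_eq_mult mult.commute lessThan_atLeast0)
  then show ?thesis using assms by (simp add: take_bit_nat_eq_self)
qed

lemma sum_bin_digit: "(\<Sum>i\<le>top_bit u. bin_digit u i * 2 ^ i) = card (same_counts u)"
  using sum_bits_eq[OF power_top_bit(2), of u]
  by (simp only: bin_digit_def lessThan_Suc_atMost)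

lemma delta_prob_nonneg: "delta_prob u d \<ge> 0"
  by (simp add: delta_prob_def)

lemma sum_delta_prob: "(\<Sum>d\<le>top_bit u. delta_prob u d) = 1"
proof -
  have "(\<Sum>d\<le>top_bit u. delta_prob u d)
      = real (\<Sum>i\<le>top_bit u. bin_digit u i * 2 ^ i) / real (card (same_counts u))"
    by (simp add: delta_prob_def sum_divide_distrib)
  also have "\<dots> = 1" using card_same_counts_pos[of u] by (simp only: sum_bin_digit) simp
  finally show ?thesis .
qed

text \<open>The tail sums \<open>F e\<close> of the binary expansion decrease from |S_u| at
  \<open>e = 0\<close> to 0 beyond the top bit. At \<open>d\<close> they first pass from above
  \<tau> to at most \<tau>; the drop is positive, so digit \<open>d\<close> is 1 and the remainder
  is below \<open>2 ^ d\<close>.\<close>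

lemma index_decomposition:
  assumes "\<tau> < card (same_counts u)"
  obtains d r where "d \<le> top_bit u" "bin_digit u d = 1" "r < 2 ^ d"
    "\<tau> = (\<Sum>l = d + 1..top_bit u. bin_digit u l * 2 ^ l) + r"
proof -
  define m where "m = top_bit u"
  define F where "F e = (\<Sum>l = e..m. bin_digit u l * 2 ^ l)" for e
  have "F 0 = card (same_counts u)"
    using sum_bin_digit[of u] by (simp add: F_def m_def atLeast0AtMost)
  then have "\<not> F 0 \<le> \<tau>" using assms by simp
  moreover have "F (Suc m) \<le> \<tau>" by (simp add: F_def)
  ultimately obtain d where d: "d < Suc m" "\<not> F d \<le> \<tau>" "F (Suc d) \<le> \<tau>"
    using ex_least_nat_less[of "\<lambda>e. F e \<le> \<tau>" "Suc m"] by blast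
  have "F d = bin_digit u d * 2 ^ d + F (Suc d)"
    unfolding F_def using d(1) by (subst sum.atLeast_Suc_atMost) auto
  moreover have "bin_digit u d = 0 \<or> bin_digit u d = 1" by (simp add: bin_digit_def)
  ultimately have "bin_digit u d = 1" "\<tau> - F (Suc d) < 2 ^ d" using d(2,3) by auto
  then show thesis using d by (intro that[of d "\<tau> - F (Suc d)"]) (auto simp: F_def m_def)
qed

section \<open>Lower bound for the expectation of \<Delta>\<close>

text \<open>Concavity: on [1/2, 1] the logarithm lies above its chord through (1/2, -1) and (1, 0),
  here evaluated at \<open>1 / c\<close>.\<close>

lemma log_le_two_minus:
  fixes c :: real
  assumes "1 \<le> c" "c \<le> 2"
  shows "log 2 c \<le> 2 - 2 / c"
proof -
  have "- log 2 ((1 - t) *\<^sub>R (1/2) + t *\<^sub>R 1) \<le> (1 - t) * - log 2 (1/2) + t * - log 2 1"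
    if "0 \<le> t" "t \<le> 1" for t :: real
    using that by (intro convex_onD[OF minus_log_convex]) auto
  \<comment> \<open>The weight \<open>2 / c - 1\<close> makes the convex combination of 1/2 and 1
    equal to \<open>1 / c\<close>.\<close>
  from this[of "2 / c - 1"] assms have "- log 2 (1 / c) \<le> 2 - 2 / c"
    by (simp add: field_simps log_divide)
  then show ?thesis using assms by (simp add: log_divide)
qed

text \<open>Raising \<open>m\<close> by one adds \<open>2 ^ i\<close> to each term, in total a
  geometric sum; this gives the exact value by induction.\<close>

lemma sum_mult_power_le: "(\<Sum>i\<le>m. real (m - i) * 2 ^ i) \<le> 2 * 2 ^ m"
proof -
  have "(\<Sum>i\<le>m. real (m - i) * 2 ^ i) = 2 * 2 ^ m - real m - 2"
  proof (induction m)
    case (Suc m)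
    have "(\<Sum>i\<le>Suc m. real (Suc m - i) * 2 ^ i) = (\<Sum>i\<le>m. real (m - i) * 2 ^ i + 2 ^ i)"
      by (auto intro!: sum.cong simp: Suc_diff_le algebra_simps)
    also have "\<dots> = (\<Sum>i\<le>m. real (m - i) * 2 ^ i) + (2 ^ Suc m - 1)"
      using sum_gp_basic[of "2::real" m] by (simp only: sum.distrib) simp
    finally show ?case using Suc by simp
  qed simp
  then show ?thesis by simp
qed

text \<open>This is where the constant 2 comes from: with \<open>|S\<^sub>u| = 2\<^sup>m c\<close>, the deficit of the expectation
  from \<open>m\<close> is at most \<open>2 / c\<close>, while \<open>log c \<le> 2 - 2 / c\<close>.\<close>

lemma delta_expectation_ge:
  "log 2 (card (same_counts u)) - 2 \<le> (\<Sum>d\<le>top_bit u. delta_prob u d * real d)"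
proof -
  define m where "m = top_bit u"
  define C where "C = real (card (same_counts u))"
  define c where "c = C / 2 ^ m"
  have C: "C > 0" by (simp add: C_def card_same_counts_pos)
  have "2 ^ m \<le> C" "C \<le> 2 * 2 ^ m"
    using power_top_bit(1)[of u, THEN of_nat_mono[where 'a = real]]
      power_top_bit(2)[of u, THEN less_imp_le, THEN of_nat_mono[where 'a = real]]
    by (simp_all add: C_def m_def)
  then have c: "1 \<le> c" "c \<le> 2" by (simp_all add: c_def field_simps)
  have "log 2 C = real m + log 2 c"
    using C by (simp add: c_def log_divide log_nat_power)
  also have "\<dots> \<le> real m + 2 - 2 / c" using log_le_two_minus[OF c] by simp
  finally have 1: "log 2 C - 2 \<le> real m - 2 / c" by simp
  \<comment> \<open>The probabilities sum to 1, so the deficit from \<open>m\<close> is the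
    expectation of \<open>m - d\<close>.\<close>
  have "real m - (\<Sum>d\<le>m. delta_prob u d * real d)
      = (\<Sum>d\<le>m. delta_prob u d) * real m - (\<Sum>d\<le>m. delta_prob u d * real d)"
    by (simp add: m_def sum_delta_prob)
  also have "\<dots> = (\<Sum>d\<le>m. delta_prob u d * real (m - d))"
    by (simp add: sum_distrib_right flip: sum_subtractf)
       (auto intro!: sum.cong simp: of_nat_diff algebra_simps)
  \<comment> \<open>Binary digits are at most 1, so each probability is at most
    \<open>2 ^ d / C\<close>.\<close>
  also have "\<dots> \<le> (\<Sum>d\<le>m. (real (m - d) * 2 ^ d) / C)"
    using C by (intro sum_mono) (auto simp: delta_prob_def bin_digit_def m_def C_def mult.commute)
  also have "\<dots> = (\<Sum>d\<le>m. (real (m - d) * 2 ^ d)) / C" by (simp add: sum_divide_distrib)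
  also have "\<dots> \<le> 2 * 2 ^ m / C" using C sum_mult_power_le[of m] by (intro divide_right_mono) auto
  also have "\<dots> = 2 / c" by (simp add: c_def)
  finally show ?thesis using 1 by (simp add: C_def m_def)
qed

section \<open>Words of i.i.d. letters and block indexing\<close>

lemma pmf_replicate_pmf:
  "pmf (replicate_pmf n p) xs = (if length xs = n then prod_list (map (pmf p) xs) else 0)"
proof (cases "length xs = n")
  case True
  then show ?thesis
  proof (induction xs arbitrary: n)
    case (Cons x xs)
    have "replicate_pmf (Suc (length xs)) p
        = map_pmf (\<lambda>(x, xs). x # xs) (pair_pmf p (replicate_pmf (length xs) p))"
      by (simp add: pair_pmf_def map_bind_pmf)
    also have "pmf \<dots> (case (x, xs) of (x, xs) \<Rightarrow> x # xs)
        = pmf (pair_pmf p (replicate_pmf (length xs) p)) (x, xs)"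
      by (rule pmf_map_inj') (auto simp: inj_on_def)
    finally show ?case using Cons by (auto simp: pmf_pair)
  qed simp
next
  case False
  then have "xs \<notin> set_pmf (replicate_pmf n p)" by (simp add: set_replicate_pmf)
  then show ?thesis using False by (simp add: set_pmf_iff)
qed

lemma prod_list_map_eq_prod_nth: "prod_list (map f xs) = (\<Prod>j<length xs. f (xs ! j))"
  by (simp add: prod.list_conv_set_nth lessThan_atLeast0)

text \<open>Offset \<open>j\<close> in block \<open>k\<close> is the flat index
  \<open>k * n + j\<close>. This rewrites products along that correspondence, and
  \<open>all_div_mod\<close> does the same for quantifiers.\<close>

lemma prod_div_mod:
  fixes n :: nat
  shows "(\<Prod>i<N * n. f (i div n) (i mod n)) = (\<Prod>k<N. \<Prod>j<n. f k j)"
proof -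
  have *: "i div n = k" "i mod n = i - k * n" if "k * n \<le> i" "i < k * n + n" for i k
  proof -
    show "i div n = k" using that by (intro div_nat_eqI) (auto simp: mult.commute)
    then show "i mod n = i - k * n" by (metis minus_div_mult_eq_mod)
  qed
  have "(\<Prod>i = k * n..<k * n + n. f (i div n) (i mod n)) = (\<Prod>j<n. f k j)" for k
    by (rule prod.reindex_bij_witness[of _ "\<lambda>j. k * n + j" "\<lambda>i. i - k * n"])
       (auto simp: *)
  then show ?thesis by (simp flip: prod.nat_group)
qed

lemma all_div_mod:
  fixes n :: nat
  shows "(\<forall>i<N * n. P (i div n) (i mod n)) \<longleftrightarrow> (\<forall>k<N. \<forall>j<n. P k j)"
proof (intro iffI allI impI)
  fix k j assume *: "\<forall>i<N * n. P (i div n) (i mod n)" "k < N" "j < n"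
  have "k * n + j < Suc k * n" using \<open>j < n\<close> by simp
  also have "\<dots> \<le> N * n" using \<open>k < N\<close> by (intro mult_le_mono1) simp
  finally show "P k j" using *(1)[rule_format, of "k * n + j"] \<open>j < n\<close> by simp
next
  fix i assume *: "\<forall>k<N. \<forall>j<n. P k j" "i < N * n"
  then have "n > 0" by (cases n) auto
  then show "P (i div n) (i mod n)" using * by (simp add: less_mult_imp_div_less)
qed

lemma block_eq_iff: "block n x k = u \<longleftrightarrow> length u = n \<and> (\<forall>j<n. x (k * n + j) = u ! j)"
  by (auto simp: block_def list_eq_iff_nth_eq)

lemma length_block: "length (block n x k) = n"
  by (simp add: block_def)

section \<open>Joint law of blocks, choices and secret sequence\<close>

lemma prob_blocks:
  assumes "prob_space M" "iid M x \<mu>" and len: "\<And>k. k < N \<Longrightarrow> length (us k) = n"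
  shows "measure M {\<omega> \<in> space M. \<forall>k<N. block n (\<lambda>i. x i \<omega>) k = us k}
    = (\<Prod>k<N. prod_list (map (pmf \<mu>) (us k)))"
proof -
  have "{\<omega> \<in> space M. \<forall>k<N. block n (\<lambda>i. x i \<omega>) k = us k}
      = {\<omega> \<in> space M. \<forall>i<N * n. x (i div n * n + i mod n) \<omega> = us (i div n) ! (i mod n)}"
    using len by (subst all_div_mod) (auto simp: block_eq_iff)
  also have "measure M \<dots> = (\<Prod>i<N * n. pmf \<mu> (us (i div n) ! (i mod n)))"
    using iid_prefix[OF assms(1,2), of "N * n" "\<lambda>i. us (i div n) ! (i mod n)"] by simp
  also have "\<dots> = (\<Prod>k<N. prod_list (map (pmf \<mu>) (us k)))"
    using len prod_div_mod[of "\<lambda>k j. pmf \<mu> (us k ! j)" n N]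
    by (simp add: prod_list_map_eq_prod_nth)
  finally show ?thesis .
qed

text \<open>\<open>block_choices\<close> gives conditional probabilities; multiplying by the
  probability of the blocks turns them into joint ones.\<close>

lemma prob_block_choices:
  assumes "prob_space M" "iid M x \<mu>" "block_choices M n x y D"
    and len: "\<And>k. k < N \<Longrightarrow> length (us k) = n"
    and E: "E \<in> sets (PiM UNIV (\<lambda>_. count_space UNIV))"
  shows "measure M {\<omega> \<in> space M. (\<forall>k<N. block n (\<lambda>i. x i \<omega>) k = us k \<and> D k \<omega> = ds k)
      \<and> (\<lambda>i. y i \<omega>) \<in> E}
    = (\<Prod>k<N. prod_list (map (pmf \<mu>) (us k)) * delta_prob (us k) (ds k))
      * measure M {\<omega> \<in> space M. (\<lambda>i. y i \<omega>) \<in> E}"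
proof -
  interpret prob_space M by fact
  have [measurable]: "x i \<in> measurable M (count_space UNIV)" for i
    using assms(2) by (auto simp: iid_def indep_vars_def)
  define Q where "Q = prob {\<omega> \<in> space M. \<forall>k<N. block n (\<lambda>i. x i \<omega>) k = us k}"
  have Q: "Q = (\<Prod>k<N. prod_list (map (pmf \<mu>) (us k)))"
    unfolding Q_def by (rule prob_blocks[OF assms(1,2) len])
  define J where "J = prob {\<omega> \<in> space M. (\<forall>k<N. block n (\<lambda>i. x i \<omega>) k = us k \<and> D k \<omega> = ds k)
      \<and> (\<lambda>i. y i \<omega>) \<in> E}"
  define Y where "Y = prob {\<omega> \<in> space M. (\<lambda>i. y i \<omega>) \<in> E}"
  have "J \<le> Q"
    unfolding J_def Q_def by (rule finite_measure_mono) (auto simp: block_eq_iff)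
  have "J = Q * ((\<Prod>k<N. delta_prob (us k) (ds k)) * Y)"
  proof (cases "Q = 0")
    case True
    then show ?thesis using \<open>J \<le> Q\<close> by (simp add: J_def measure_le_0_iff)
  next
    case False
    then have "Q > 0" by (simp add: Q_def zero_less_measure_iff)
    have "cond_prob M (\<lambda>\<omega>. (\<forall>k<N. D k \<omega> = ds k) \<and> (\<lambda>i. y i \<omega>) \<in> E)
        (\<lambda>\<omega>. \<forall>k<N. block n (\<lambda>i. x i \<omega>) k = us k) = (\<Prod>k<N. delta_prob (us k) (ds k)) * Y"
      using assms(3) E \<open>Q > 0\<close> by (simp add: block_choices_def Q_def Y_def)
    moreover have "{\<omega> \<in> space M. ((\<forall>k<N. D k \<omega> = ds k) \<and> (\<lambda>i. y i \<omega>) \<in> E) \<and>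
        (\<forall>k<N. block n (\<lambda>i. x i \<omega>) k = us k)}
      = {\<omega> \<in> space M. (\<forall>k<N. block n (\<lambda>i. x i \<omega>) k = us k \<and> D k \<omega> = ds k) \<and> (\<lambda>i. y i \<omega>) \<in> E}"
      by auto
    ultimately have "J / Q = (\<Prod>k<N. delta_prob (us k) (ds k)) * Y"
      by (simp add: cond_prob_def J_def Q_def)
    then show ?thesis using \<open>Q > 0\<close> by (simp add: field_simps)
  qed
  then show ?thesis by (simp add: J_def Y_def Q prod.distrib mult.assoc)
qed

section \<open>Secret bits that force a prescribed output\<close>

lemma read_pos_add_less:
  assumes "k < N" "j < d k"
  shows "read_pos d k + j < read_pos d N"
proof -
  have "read_pos d k + j < read_pos d (Suc k)" using assms by (simp add: read_pos_def)
  also have "\<dots> \<le> read_pos d N"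
    unfolding read_pos_def using assms by (intro sum_mono2) auto
  finally show ?thesis .
qed

text \<open>The stretches read for successive blocks are adjacent and disjoint, so strings
  prescribed block by block fit into one sequence.\<close>

lemma concat_choices:
  "\<exists>b. \<forall>k<N. \<forall>j<d k. b (read_pos d k + j) = c k j"
proof (induction N)
  case (Suc N)
  then obtain b where b: "\<forall>k<N. \<forall>j<d k. b (read_pos d k + j) = c k j" by blast
  define b' where "b' i = (if i < read_pos d N then b i else c N (i - read_pos d N))" for i
  have "\<forall>k<Suc N. \<forall>j<d k. b' (read_pos d k + j) = c k j"
    using b by (auto simp: b'_def less_Suc_eq read_pos_add_less)
  then show ?case by blast
qed simp

lemma sum_bits_msb_first:
  fixes r :: nat
  assumes "r < 2 ^ d"
  shows "(\<Sum>i<d. of_bool (bit r (d - 1 - i)) * 2 ^ (d - 1 - i)) = r"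
proof -
  have "(\<Sum>i<d. of_bool (bit r (d - 1 - i)) * 2 ^ (d - 1 - i))
      = (\<Sum>i<d. of_bool (bit r i) * 2 ^ i :: nat)"
    using sum.nat_diff_reindex[of "\<lambda>i. of_bool (bit r i) * 2 ^ i :: nat" d] by simp
  also have "\<dots> = r" by (rule sum_bits_eq[OF assms])
  finally show ?thesis .
qed

text \<open>The values of \<Delta> are fixed first, because they determine the reading positions;
  the bits are then placed there. Quantifying over all \<open>x\<close>, \<open>y\<close>,
  \<open>d\<close> that agree with these data allows application at each sample point.\<close>

lemma ex_choices_for_output:
  assumes bij: "\<And>k. k < N \<Longrightarrow>
      bij_betw (s (same_counts (us k))) {..<card (same_counts (us k))} (same_counts (us k))"
    and ws: "\<And>k. k < N \<Longrightarrow> ws k \<in> same_counts (us k)"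
  shows "\<exists>ds b. \<forall>k<N. ds k \<le> top_bit (us k) \<and> bin_digit (us k) (ds k) = 1 \<and>
    (\<forall>x y d. block n x k = us k \<longrightarrow> (\<forall>j<N. d j = ds j) \<longrightarrow> (\<forall>i<read_pos ds N. y i = b i)
      \<longrightarrow> out_block s n x y d k = ws k)"
proof -
  define P where "P k d r \<longleftrightarrow> d \<le> top_bit (us k) \<and> bin_digit (us k) d = 1 \<and> r < 2 ^ d \<and>
    s (same_counts (us k)) ((\<Sum>l = d + 1..top_bit (us k). bin_digit (us k) l * 2 ^ l) + r) = ws k"
    for k d r
  have "\<exists>d r. P k d r" if k: "k < N" for k
  proof -
    obtain \<tau> where \<tau>: "\<tau> < card (same_counts (us k))" "s (same_counts (us k)) \<tau> = ws k"
      using bij[OF k] ws[OF k] unfolding bij_betw_def by (metis imageE lessThan_iff)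
    obtain d r where "d \<le> top_bit (us k)" "bin_digit (us k) d = 1" "r < 2 ^ d"
      "\<tau> = (\<Sum>l = d + 1..top_bit (us k). bin_digit (us k) l * 2 ^ l) + r"
      using index_decomposition[OF \<tau>(1)] .
    then have "P k d r" using \<tau>(2) by (simp add: P_def)
    then show ?thesis by blast
  qed
  then obtain ds r where P: "\<And>k. k < N \<Longrightarrow> P k (ds k) (r k)" by metis
  note dr = P[unfolded P_def]
  \<comment> \<open>Offset \<open>j\<close> carries bit \<open>ds k - 1 - j\<close> because
    \<open>read_int\<close> takes the most significant bit first.\<close>
  obtain b where b: "\<forall>k<N. \<forall>j<ds k. b (read_pos ds k + j) = bit (r k) (ds k - 1 - j)"
    using concat_choices[of N ds "\<lambda>k j. bit (r k) (ds k - 1 - j)"] by blast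
  have "out_block s n x y d k = ws k"
    if k: "k < N" and u: "block n x k = us k" and d: "\<forall>j<N. d j = ds j"
      and y: "\<forall>i<read_pos ds N. y i = b i" for k x y d
  proof -
    have pos: "read_pos d k = read_pos ds k" using d k by (simp add: read_pos_def)
    have "read_int y d k = (\<Sum>i<ds k. of_bool (bit (r k) (ds k - 1 - i)) * 2 ^ (ds k - 1 - i))"
      using b y d k pos by (auto simp: read_int_def read_pos_add_less intro!: sum.cong)
    also have "\<dots> = r k" using dr[OF k] by (intro sum_bits_msb_first) simp
    finally show ?thesis using dr[OF k] d k u by (simp add: out_block_def Let_def)
  qed
  then show ?thesis using dr by blast
qed

section \<open>Law of the output sequence\<close>

text \<open>Reading positions and lengths are random but take countably many values, so each can be
  frozen at a constant in turn.\<close>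

lemma measurable_out_block:
  fixes x :: "nat \<Rightarrow> 'w \<Rightarrow> 'a::countable"
  assumes x: "\<And>i. x i \<in> measurable M (count_space UNIV)"
    and y: "\<And>i. y i \<in> measurable M (count_space UNIV)"
    and D: "\<And>k. D k \<in> measurable M (count_space UNIV)"
  shows "(\<lambda>\<omega>. out_block s n (\<lambda>i. x i \<omega>) (\<lambda>i. y i \<omega>) (\<lambda>k. D k \<omega>) k)
    \<in> measurable M (count_space UNIV)"
proof -
  have block: "(\<lambda>\<omega>. block n (\<lambda>i. x i \<omega>) k) \<in> measurable M (count_space UNIV)"
    unfolding block_def by (rule measurable_map_upt) (rule x)
  have pos: "(\<lambda>\<omega>. read_pos (\<lambda>k. D k \<omega>) k) \<in> measurable M (count_space UNIV)"
  proof (induction k)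
    case (Suc k)
    then show ?case
      using measurable_countable2[OF Suc D[of k], of "(+)"] by (simp add: read_pos_def)
  qed (simp add: read_pos_def)
  have bits: "(\<lambda>\<omega>. map (\<lambda>i. y (read_pos (\<lambda>k. D k \<omega>) k + i) \<omega>) [0..<c])
      \<in> measurable M (count_space UNIV)" for c
  proof (rule measurable_map_upt)
    show "(\<lambda>\<omega>. y (read_pos (\<lambda>k. D k \<omega>) k + j) \<omega>) \<in> measurable M (count_space UNIV)" for j
      by (rule measurable_compose_countable[OF _ pos]) (rule y)
  qed
  have int: "(\<lambda>\<omega>. read_int (\<lambda>i. y i \<omega>) (\<lambda>k. D k \<omega>) k) \<in> measurable M (count_space UNIV)"
  proof -
    have "(\<lambda>\<omega>. (\<lambda>c bs. \<Sum>i<c. of_bool (bs ! i) * 2 ^ (c - 1 - i) :: nat) (D k \<omega>)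
        (map (\<lambda>i. y (read_pos (\<lambda>k. D k \<omega>) k + i) \<omega>) [0..<D k \<omega>])) \<in> measurable M (count_space UNIV)"
    proof (rule measurable_compose_countable[OF _ D])
      show "(\<lambda>\<omega>. (\<lambda>c bs. \<Sum>i<c. of_bool (bs ! i) * 2 ^ (c - 1 - i) :: nat) c
          (map (\<lambda>i. y (read_pos (\<lambda>k. D k \<omega>) k + i) \<omega>) [0..<c])) \<in> measurable M (count_space UNIV)" for c
        by (rule measurable_compose[OF bits]) simp
    qed
    then show ?thesis by (simp add: read_int_def)
  qed
  show ?thesis
    unfolding out_block_def Let_def
    by (rule measurable_compose_countable[OF _ block],
        rule measurable_compose_countable[OF _ D], rule measurable_compose[OF int]) simp
qed

text \<open>The events \<open>B us\<close> below account for the whole probability, but only the lower bound is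
  needed, so nothing has to be said about other ways of producing \<open>ws\<close>.\<close>

lemma prob_out_blocks_ge:
  fixes x :: "nat \<Rightarrow> 'w \<Rightarrow> 'a::countable"
  assumes "prob_space M" and "iid M x \<mu>" and "iid M y (pmf_of_set UNIV)"
    and "block_choices M n x y D"
    and bij: "\<And>u. length u = n \<Longrightarrow>
           bij_betw (s (same_counts u)) {..<card (same_counts u)} (same_counts u)"
    and len: "\<And>k. k < N \<Longrightarrow> length (ws k) = n"
  shows "(\<Prod>k<N. prod_list (map (pmf \<mu>) (ws k))) \<le>
    measure M {\<omega> \<in> space M. \<forall>k<N. out_block s n (\<lambda>i. x i \<omega>) (\<lambda>i. y i \<omega>) (\<lambda>k. D k \<omega>) k = ws k}"
proof -
  interpret prob_space M by fact
  have x[measurable]: "x i \<in> measurable M (count_space UNIV)"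
    and y[measurable]: "y i \<in> measurable M (count_space UNIV)"
    and D[measurable]: "D i \<in> measurable M (count_space UNIV)" for i
    using assms(2-4) by (auto simp: iid_def indep_vars_def block_choices_def)
  note measurable_out_block[OF x y D, measurable]
  have [measurable]: "(\<lambda>\<omega>. block n (\<lambda>i. x i \<omega>) k) \<in> measurable M (count_space UNIV)" for k
    unfolding block_def by (rule measurable_map_upt) (rule x)
  \<comment> \<open>The input blocks that can lead to \<open>ws\<close>. Extensionality makes
    \<open>U\<close> finite and forces members that agree below \<open>N\<close> to coincide, which
    gives disjoint events later.\<close>
  define U where "U = (\<Pi>\<^sub>E k\<in>{..<N}. same_counts (ws k))"
  have fin_U: "finite U" unfolding U_def by (intro finite_PiE) (auto simp: finite_same_counts)
  have U: "us k \<in> same_counts (ws k)" "same_counts (us k) = same_counts (ws k)"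
      "ws k \<in> same_counts (us k)" "length (us k) = n" if "us \<in> U" "k < N" for us k
  proof -
    show *: "us k \<in> same_counts (ws k)" using that by (auto simp: U_def)
    then show "same_counts (us k) = same_counts (ws k)" by (rule same_counts_cong)
    then show "ws k \<in> same_counts (us k)" by (auto simp: same_counts_def)
    show "length (us k) = n" using * len[OF that(2)] by (simp add: same_counts_def)
  qed
  define P where "P us ds b \<longleftrightarrow> (\<forall>k<N. ds k \<le> top_bit (us k) \<and> bin_digit (us k) (ds k) = 1 \<and>
    (\<forall>x y d. block n x k = us k \<longrightarrow> (\<forall>j<N. d j = ds j) \<longrightarrow> (\<forall>i<read_pos ds N. y i = b i)
      \<longrightarrow> out_block s n x y d k = ws k))" for us ds b
  have "\<exists>ds b. P us ds b" if "us \<in> U" for us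
    unfolding P_def using U(3)[OF that] bij[OF U(4)[OF that]] by (intro ex_choices_for_output)
  then obtain ds b where P: "\<And>us. us \<in> U \<Longrightarrow> P us (ds us) (b us)" by metis
  then have db: "ds us k \<le> top_bit (us k)" "bin_digit (us k) (ds us k) = 1"
      "\<lbrakk>block n x k = us k; \<And>j. j < N \<Longrightarrow> d j = ds us j; \<And>i. i < read_pos (ds us) N \<Longrightarrow> y i = b us i\<rbrakk>
        \<Longrightarrow> out_block s n x y d k = ws k" if "us \<in> U" "k < N" for us k x y d
    using that unfolding P_def by simp_all
  \<comment> \<open>On \<open>B us\<close> the inputs are \<open>us\<close>, and the choices and
    secret bits are those that force the outputs \<open>ws\<close>.\<close>
  define B where "B us = {\<omega> \<in> space M. (\<forall>k<N. block n (\<lambda>i. x i \<omega>) k = us k \<and> D k \<omega> = ds us k)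
      \<and> (\<lambda>i. y i \<omega>) \<in> {f. \<forall>i<read_pos (ds us) N. f i = b us i}}" for us
  have B_sets: "B us \<in> events" for us unfolding B_def mem_Collect_eq by measurable
  have prob_B: "prob (B us) = (\<Prod>k<N. prod_list (map (pmf \<mu>) (ws k)) / card (same_counts (ws k)))"
    if us: "us \<in> U" for us
  proof -
    let ?T = "read_pos (ds us) N"
    have "{f \<in> space (PiM UNIV (\<lambda>_. count_space UNIV)). \<forall>i<?T. f i = b us i}
        \<in> sets (PiM UNIV (\<lambda>_. count_space UNIV))"
      by measurable
    then have E: "{f. \<forall>i<?T. f i = b us i} \<in> sets (PiM UNIV (\<lambda>_. count_space UNIV))"
      by (simp add: space_PiM)
    \<comment> \<open>\<open>?T\<close> is the total number of bits read; each prescribed bit has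
      probability 1/2.\<close>
    have "prob {\<omega> \<in> space M. (\<lambda>i. y i \<omega>) \<in> {f. \<forall>i<?T. f i = b us i}} = (\<Prod>k<?T. 1 / 2)"
      using iid_prefix[OF assms(1,3), of ?T "b us"] by simp
    also have "\<dots> = (\<Prod>k<N. (1 / 2) ^ ds us k)"
      by (simp add: read_pos_def power_sum)
    finally have "prob (B us) = (\<Prod>k<N. prod_list (map (pmf \<mu>) (us k)) * delta_prob (us k) (ds us k))
        * (\<Prod>k<N. (1 / 2) ^ ds us k)"
      unfolding B_def using prob_block_choices[OF assms(1,2,4) U(4)[OF us] E] by simp
    also have "\<dots> = (\<Prod>k<N. prod_list (map (pmf \<mu>) (us k)) * delta_prob (us k) (ds us k)
        * (1 / 2) ^ ds us k)"
      by (simp add: prod.distrib)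
    \<comment> \<open>The factor \<open>2 ^ ds us k\<close> in \<open>delta_prob\<close> cancels the
      probability of the bits, so the value no longer depends on \<open>us\<close>.\<close>
    also have "\<dots> = (\<Prod>k<N. prod_list (map (pmf \<mu>) (ws k)) / card (same_counts (ws k)))"
    proof (rule prod.cong[OF refl])
      fix k assume "k \<in> {..<N}"
      then have k: "k < N" by simp
      show "prod_list (map (pmf \<mu>) (us k)) * delta_prob (us k) (ds us k) * (1 / 2) ^ ds us k
          = prod_list (map (pmf \<mu>) (ws k)) / card (same_counts (ws k))"
        using prod_list_same_counts[OF U(1)[OF us k], of "pmf \<mu>"] db(1,2)[OF us k] U(2)[OF us k]
        by (simp add: delta_prob_def power_one_over)
    qed
    finally show ?thesis .
  qed
  have disj: "disjoint_family_on B U"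
  proof -
    have "us = vs" if "us \<in> U" "vs \<in> U" "\<omega> \<in> B us" "\<omega> \<in> B vs" for us vs \<omega>
      using that unfolding U_def by (intro PiE_ext) (auto simp: B_def)
    then show ?thesis by (auto simp: disjoint_family_on_def)
  qed
  \<comment> \<open>The cardinalities in the denominators are compensated by the number of elements
    of \<open>U\<close>.\<close>
  have "(\<Prod>k<N. prod_list (map (pmf \<mu>) (ws k)))
      = (\<Prod>k<N. card (same_counts (ws k)) * (prod_list (map (pmf \<mu>) (ws k)) / card (same_counts (ws k))))"
    by (intro prod.cong refl) (simp add: gr_implies_not0[OF card_same_counts_pos])
  also have "\<dots> = card U * (\<Prod>k<N. prod_list (map (pmf \<mu>) (ws k)) / card (same_counts (ws k)))"
    by (simp only: U_def card_PiE finite_lessThan of_nat_prod prod.distrib)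
  also have "\<dots> = (\<Sum>us\<in>U. prob (B us))" by (simp add: prob_B)
  also have "\<dots> = prob (\<Union>us\<in>U. B us)"
    using fin_U B_sets disj by (intro finite_measure_finite_Union[symmetric]) auto
  also have "\<dots> \<le> prob {\<omega> \<in> space M. \<forall>k<N.
      out_block s n (\<lambda>i. x i \<omega>) (\<lambda>i. y i \<omega>) (\<lambda>k. D k \<omega>) k = ws k}"
  proof (rule finite_measure_mono)
    show "(\<Union>us\<in>U. B us) \<subseteq> {\<omega> \<in> space M. \<forall>k<N.
      out_block s n (\<lambda>i. x i \<omega>) (\<lambda>i. y i \<omega>) (\<lambda>k. D k \<omega>) k = ws k}"
    proof safe
      fix us \<omega> k assume *: "us \<in> U" "\<omega> \<in> B us" "k < N"
      then show "out_block s n (\<lambda>i. x i \<omega>) (\<lambda>i. y i \<omega>) (\<lambda>k. D k \<omega>) k = ws k"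
        by (intro db(3)[OF *(1,3)]) (auto simp: B_def)
    qed (auto simp: B_def)
  qed measurable
  finally show ?thesis .
qed

text \<open>A prefix of length \<open>N * n\<close> consists of \<open>N\<close> output blocks, so
  the bound for blocks is the prefix bound that implies the i.i.d. property.\<close>

lemma iid_stego_out:
  fixes x :: "nat \<Rightarrow> 'w \<Rightarrow> 'a::countable"
  assumes "prob_space M" and "iid M x \<mu>" and "iid M y (pmf_of_set UNIV)"
    and "block_choices M n x y D"
    and bij: "\<And>u. length u = n \<Longrightarrow>
           bij_betw (s (same_counts u)) {..<card (same_counts u)} (same_counts u)"
    and "n > 0"
  shows "iid M (\<lambda>j \<omega>. stego_out s n (\<lambda>i. x i \<omega>) (\<lambda>i. y i \<omega>) (\<lambda>k. D k \<omega>) j) \<mu>"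
proof (rule iid_if_prefix_lower_bound[OF assms(1) \<open>n > 0\<close>])
  interpret prob_space M by fact
  have x: "x i \<in> measurable M (count_space UNIV)"
    and y: "y i \<in> measurable M (count_space UNIV)"
    and D: "D i \<in> measurable M (count_space UNIV)" for i
    using assms(2-4) by (auto simp: iid_def indep_vars_def block_choices_def)
  show X: "(\<lambda>\<omega>. stego_out s n (\<lambda>i. x i \<omega>) (\<lambda>i. y i \<omega>) (\<lambda>k. D k \<omega>) j)
      \<in> measurable M (count_space UNIV)" for j
    unfolding stego_out_def by (rule measurable_compose[OF measurable_out_block[OF x y D]]) simp
  fix N and a :: "nat \<Rightarrow> 'a"
  have "(\<Prod>j<N * n. pmf \<mu> (a j)) = (\<Prod>i<N * n. pmf \<mu> (a (i div n * n + i mod n)))" by simp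
  also have "\<dots> = (\<Prod>k<N. prod_list (map (pmf \<mu>) (block n a k)))"
    by (subst prod_div_mod) (simp add: prod_list_map_eq_prod_nth length_block, simp add: block_def)
  also have "\<dots> \<le> prob {\<omega> \<in> space M. \<forall>k<N.
      out_block s n (\<lambda>i. x i \<omega>) (\<lambda>i. y i \<omega>) (\<lambda>k. D k \<omega>) k = block n a k}"
    by (rule prob_out_blocks_ge[OF assms(1-4) bij]) (auto simp: length_block)
  also have "\<dots> \<le> prob {\<omega> \<in> space M. \<forall>j<N * n.
      stego_out s n (\<lambda>i. x i \<omega>) (\<lambda>i. y i \<omega>) (\<lambda>k. D k \<omega>) j = a j}"
  proof (rule finite_measure_mono)
    show "{\<omega> \<in> space M. \<forall>k<N.
        out_block s n (\<lambda>i. x i \<omega>) (\<lambda>i. y i \<omega>) (\<lambda>k. D k \<omega>) k = block n a k}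
      \<subseteq> {\<omega> \<in> space M. \<forall>j<N * n. stego_out s n (\<lambda>i. x i \<omega>) (\<lambda>i. y i \<omega>) (\<lambda>k. D k \<omega>) j = a j}"
      using \<open>n > 0\<close> by (auto simp: stego_out_def block_def less_mult_imp_div_less)
    note X[measurable]
    show "{\<omega> \<in> space M. \<forall>j<N * n.
      stego_out s n (\<lambda>i. x i \<omega>) (\<lambda>i. y i \<omega>) (\<lambda>k. D k \<omega>) j = a j} \<in> events"
      by measurable
  qed
  finally show "(\<Prod>j<N * n. pmf \<mu> (a j)) \<le> prob {\<omega> \<in> space M. \<forall>j<N * n.
      stego_out s n (\<lambda>i. x i \<omega>) (\<lambda>i. y i \<omega>) (\<lambda>k. D k \<omega>) j = a j}" .
qed

section \<open>Joint law of a block and its number of secret symbols\<close>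

definition delta_pmf :: "'a list \<Rightarrow> nat pmf" where
  "delta_pmf u = embed_pmf (delta_prob u)"

lemma pmf_delta_pmf: "pmf (delta_pmf u) d = delta_prob u d"
  unfolding delta_pmf_def
proof (rule pmf_embed_pmf)
  have "(\<integral>\<^sup>+ d. ennreal (delta_prob u d) \<partial>count_space UNIV)
      = (\<Sum>d\<le>top_bit u. ennreal (delta_prob u d))"
    by (rule nn_integral_count_space') (auto simp: delta_prob_def)
  also have "\<dots> = 1"
    by (subst sum_ennreal) (auto simp: delta_prob_nonneg sum_delta_prob)
  finally show "(\<integral>\<^sup>+ d. ennreal (delta_prob u d) \<partial>count_space UNIV) = 1" .
qed (rule delta_prob_nonneg)

lemma set_delta_pmf: "set_pmf (delta_pmf u) \<subseteq> {..top_bit u}"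
  by (auto simp: set_pmf_eq pmf_delta_pmf delta_prob_def)

definition block_choice_pmf :: "nat \<Rightarrow> 'a pmf \<Rightarrow> ('a list \<times> nat) pmf" where
  "block_choice_pmf n \<mu> = bind_pmf (replicate_pmf n \<mu>) (\<lambda>u. map_pmf (Pair u) (delta_pmf u))"

lemma pmf_block_choice_pmf:
  "pmf (block_choice_pmf n \<mu>) (u, d) = pmf (replicate_pmf n \<mu>) u * delta_prob u d"
proof -
  have *: "pmf (map_pmf (Pair v) (delta_pmf v)) (u, d) = indicator {u} v * delta_prob u d" for v
  proof (cases "v = u")
    case True
    then show ?thesis by (simp add: pmf_map_inj' inj_on_def pmf_delta_pmf)
  next
    case False
    then have "(u, d) \<notin> set_pmf (map_pmf (Pair v) (delta_pmf v))" using False by auto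
    then have "pmf (map_pmf (Pair v) (delta_pmf v)) (u, d) = 0" unfolding set_pmf_iff by simp
    then show ?thesis using False by simp
  qed
  show ?thesis
    by (simp add: block_choice_pmf_def pmf_bind * measure_pmf_single)
qed

text \<open>Taking the whole space as the event for \<open>y\<close> leaves the joint law of blocks
  and choices, which factors over the blocks.\<close>

lemma iid_block_choices:
  fixes x :: "nat \<Rightarrow> 'w \<Rightarrow> 'a::countable"
  assumes "prob_space M" and "iid M x \<mu>" and "block_choices M n x y D"
  shows "iid M (\<lambda>k \<omega>. (block n (\<lambda>i. x i \<omega>) k, D k \<omega>)) (block_choice_pmf n \<mu>)"
proof (rule iid_if_prefix_lower_bound[OF assms(1), of 1])
  interpret prob_space M by fact
  have "x i \<in> measurable M (count_space UNIV)"
    and D: "D i \<in> measurable M (count_space UNIV)" for i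
    using assms(2-3) by (auto simp: iid_def indep_vars_def block_choices_def)
  then have "(\<lambda>\<omega>. block n (\<lambda>i. x i \<omega>) k) \<in> measurable M (count_space UNIV)" for k
    unfolding block_def by (intro measurable_map_upt)
  then show "(\<lambda>\<omega>. (block n (\<lambda>i. x i \<omega>) k, D k \<omega>)) \<in> measurable M (count_space UNIV)" for k
    by (rule measurable_countable2) (rule D)
  fix N and a :: "nat \<Rightarrow> 'a list \<times> nat"
  show "(\<Prod>j<N * 1. pmf (block_choice_pmf n \<mu>) (a j))
      \<le> prob {\<omega> \<in> space M. \<forall>j<N * 1. (block n (\<lambda>i. x i \<omega>) j, D j \<omega>) = a j}"
  proof (cases "\<forall>k<N. length (fst (a k)) = n")
    case True
    have "(\<Prod>j<N. pmf (block_choice_pmf n \<mu>) (a j))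
        = (\<Prod>k<N. prod_list (map (pmf \<mu>) (fst (a k))) * delta_prob (fst (a k)) (snd (a k)))"
      using True by (intro prod.cong refl, subst prod.collapse[symmetric], subst pmf_block_choice_pmf)
        (simp add: pmf_replicate_pmf)
    also have "\<dots> = prob {\<omega> \<in> space M. (\<forall>k<N. block n (\<lambda>i. x i \<omega>) k = fst (a k) \<and> D k \<omega> = snd (a k))
        \<and> (\<lambda>i. y i \<omega>) \<in> UNIV}"
      using True by (subst prob_block_choices[OF assms])
        (auto simp: prob_space sets.top[of "PiM UNIV (\<lambda>_. count_space UNIV)", simplified space_PiM, simplified])
    also have "\<dots> = prob {\<omega> \<in> space M. \<forall>j<N * 1. (block n (\<lambda>i. x i \<omega>) j, D j \<omega>) = a j}"
      by (simp add: prod_eq_iff)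
    finally show ?thesis by simp
  next
    \<comment> \<open>A word of the wrong length has mass 0, so the product on the left
      vanishes.\<close>
    case False
    then obtain k where "k < N" "pmf (block_choice_pmf n \<mu>) (a k) = 0"
      by (metis pmf_block_choice_pmf pmf_replicate_pmf prod.collapse mult_zero_left)
    then have "(\<Prod>j<N * 1. pmf (block_choice_pmf n \<mu>) (a j)) = 0" by auto
    then show ?thesis by (simp only: measure_nonneg)
  qed
qed simp

section \<open>Expected number of secret symbols\<close>

text \<open>These bounds, uniform over words of a fixed length, give integrability for infinite
  alphabets as well.\<close>

lemma log_card_same_counts_bounds:
  "0 \<le> log 2 (card (same_counts u))" "log 2 (card (same_counts u)) \<le> log 2 (fact (length u))"
proof -
  have pos: "card (same_counts u) > 0" by (rule card_same_counts_pos)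
  then show "0 \<le> log 2 (card (same_counts u))" by simp
  have "(\<Prod>a\<in>set u. fact (count_list u a) :: real) \<ge> 1"
    by (intro prod_ge_1) (simp add: fact_ge_1)
  then have "real (card (same_counts u)) \<le> fact (length u)"
    unfolding real_card_same_counts by (simp add: divide_le_eq mult_le_cancel_left1)
  then show "log 2 (card (same_counts u)) \<le> log 2 (fact (length u))" using pos by simp
qed

lemma top_bit_le: "real (top_bit u) \<le> log 2 (fact (length u))"
proof -
  have "real (top_bit u) \<le> log 2 (card (same_counts u))"
    using log_card_same_counts_bounds(1)[of u] by (simp add: top_bit_def)
  also note log_card_same_counts_bounds(2)
  finally show ?thesis .
qed

text \<open>The 2 stands on the right because the logarithm minus 2 may be negative, and
  \<open>ennreal\<close> would truncate it to 0.\<close>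

lemma nn_integral_delta_pmf_ge:
  "ennreal (log 2 (card (same_counts u))) \<le> (\<integral>\<^sup>+ d. ennreal (real d + 2) \<partial>delta_pmf u)"
proof -
  have "log 2 (card (same_counts u)) \<le> (\<Sum>d\<le>top_bit u. delta_prob u d * (real d + 2))"
    using delta_expectation_ge[of u] sum_delta_prob[of u]
    by (simp add: distrib_left sum.distrib flip: sum_distrib_right)
  also have "ennreal \<dots> = (\<Sum>d\<le>top_bit u. ennreal (real d + 2) * pmf (delta_pmf u) d)"
    by (subst sum_ennreal[symmetric])
      (auto simp: delta_prob_nonneg pmf_delta_pmf ennreal_mult mult.commute intro!: sum.cong)
  also have "\<dots> = (\<integral>\<^sup>+ d. ennreal (real d + 2) \<partial>delta_pmf u)"
    using set_delta_pmf by (intro nn_integral_measure_pmf_support[symmetric]) auto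
  finally show ?thesis by (simp add: ennreal_leI)
qed

lemma integrable_log_card_same_counts:
  "integrable (replicate_pmf n \<mu>) (\<lambda>u. log 2 (card (same_counts u)))"
  by (rule measure_pmf.integrable_const_bound[of _ "log 2 (fact n)"])
    (use log_card_same_counts_bounds(2) in
      \<open>auto simp: AE_measure_pmf_iff set_replicate_pmf abs_of_nonneg log_card_same_counts_bounds(1)\<close>)

text \<open>The bound for a single word is averaged over the block law. Nonnegative integrals split
  the two-stage law without integrability conditions.\<close>

lemma expectation_block_choice_pmf_ge:
  "(\<integral>u. log 2 (card (same_counts u)) \<partial>replicate_pmf n \<mu>) - 2
    \<le> (\<integral>p. real (snd p) \<partial>block_choice_pmf n \<mu>)"
proof -
  define K where "K = log 2 (fact n)"
  have len: "length u = n" if "u \<in> set_pmf (replicate_pmf n \<mu>)" for u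
    using that by (auto simp: set_replicate_pmf)
  \<comment> \<open>Boundedness makes the expectation finite, which permits the return from
    \<open>ennreal\<close> to the reals.\<close>
  have "real (snd p) \<le> K" if p: "p \<in> set_pmf (block_choice_pmf n \<mu>)" for p
  proof -
    obtain u d where ud: "p = (u, d)" "u \<in> set_pmf (replicate_pmf n \<mu>)" "d \<in> set_pmf (delta_pmf u)"
      using p by (auto simp: block_choice_pmf_def)
    then have "real d \<le> real (top_bit u)" using set_delta_pmf by auto
    also have "\<dots> \<le> K" using top_bit_le[of u] len ud by (simp add: K_def)
    finally show ?thesis by (simp add: ud)
  qed
  then have int_snd: "integrable (block_choice_pmf n \<mu>) (\<lambda>p. real (snd p))"
    by (intro measure_pmf.integrable_const_bound[of _ K]) (auto simp: AE_measure_pmf_iff)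
  have "ennreal (\<integral>u. log 2 (card (same_counts u)) \<partial>replicate_pmf n \<mu>)
      = (\<integral>\<^sup>+ u. log 2 (card (same_counts u)) \<partial>replicate_pmf n \<mu>)"
    by (rule nn_integral_eq_integral[symmetric, OF integrable_log_card_same_counts]) (simp add: log_card_same_counts_bounds)
  also have "\<dots> \<le> (\<integral>\<^sup>+ u. \<integral>\<^sup>+ d. ennreal (real d + 2) \<partial>delta_pmf u \<partial>replicate_pmf n \<mu>)"
    by (intro nn_integral_mono nn_integral_delta_pmf_ge)
  also have "\<dots> = (\<integral>\<^sup>+ p. ennreal (real (snd p) + 2) \<partial>block_choice_pmf n \<mu>)"
    by (simp add: block_choice_pmf_def)
  also have "\<dots> = ennreal (\<integral>p. real (snd p) + 2 \<partial>block_choice_pmf n \<mu>)"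
    by (rule nn_integral_eq_integral) (use int_snd in auto)
  also have "(\<integral>p. real (snd p) + 2 \<partial>block_choice_pmf n \<mu>)
      = (\<integral>p. real (snd p) \<partial>block_choice_pmf n \<mu>) + 2"
    using int_snd by simp
  finally show ?thesis
    by (subst (asm) ennreal_le_iff) (auto intro!: add_nonneg_nonneg)
qed

text \<open>Integrability under \<open>p\<close> is absolute summability of the weighted terms, so
  the integral is an unordered sum, the form used in the theorem.\<close>

lemma expectation_pmf_eq_infsum:
  fixes f :: "'a \<Rightarrow> real"
  assumes "integrable (measure_pmf p) f"
  shows "(\<integral>a. f a \<partial>p) = (\<Sum>\<^sub>\<infinity>a. pmf p a * f a)"
proof -
  have "integrable (count_space UNIV) (\<lambda>a. pmf p a * f a)"
    using assms by (simp add: measure_pmf_eq_density integrable_density)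
  then show ?thesis
    unfolding pmf_expectation_eq_infsetsum
    by (intro infsetsum_infsum) (simp add: Infinite_Set_Sum.abs_summable_on_def)
qed

lemma expectation_log_card_eq_infsum:
  "(\<integral>u. log 2 (card (same_counts u)) \<partial>replicate_pmf n \<mu>)
    = (\<Sum>\<^sub>\<infinity>u \<in> {u. length u = n}. (\<Prod>j<n. pmf \<mu> (u ! j)) *
        log 2 (fact n / (\<Prod>a\<in>set u. fact (count_list u a))))"
proof -
  have "(\<integral>u. log 2 (card (same_counts u)) \<partial>replicate_pmf n \<mu>)
      = (\<Sum>\<^sub>\<infinity>u. pmf (replicate_pmf n \<mu>) u * log 2 (card (same_counts u)))"
    by (rule expectation_pmf_eq_infsum[OF integrable_log_card_same_counts])
  \<comment> \<open>Words of length other than \<open>n\<close> have mass 0.\<close>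
  also have "\<dots> = (\<Sum>\<^sub>\<infinity>u \<in> {u. length u = n}. (\<Prod>j<n. pmf \<mu> (u ! j)) *
        log 2 (fact n / (\<Prod>a\<in>set u. fact (count_list u a))))"
    by (rule infsum_cong_neutral)
      (auto simp: pmf_replicate_pmf real_card_same_counts prod_list_map_eq_prod_nth)
  finally show ?thesis .
qed

text \<open>The pair of block \<open>k\<close> and \<open>D k\<close> has the same law for every
  \<open>k\<close>, so the rate does not depend on the block from which it is computed.\<close>

lemma secret_rate_eq:
  fixes x :: "nat \<Rightarrow> 'w \<Rightarrow> 'a::countable"
  assumes "prob_space M" and "iid M x \<mu>" and "block_choices M n x y D"
  shows "secret_rate M n D k = (\<integral>p. real (snd p) \<partial>block_choice_pmf n \<mu>) / real n"
proof -
  let ?Z = "\<lambda>\<omega>. (block n (\<lambda>i. x i \<omega>) k, D k \<omega>)"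
  interpret prob_space M by fact
  have iid: "iid M (\<lambda>k \<omega>. (block n (\<lambda>i. x i \<omega>) k, D k \<omega>)) (block_choice_pmf n \<mu>)"
    by (rule iid_block_choices[OF assms])
  then have Z: "?Z \<in> measurable M (count_space UNIV)"
    by (auto simp: iid_def indep_vars_def)
  have "(\<integral>p. real (snd p) \<partial>block_choice_pmf n \<mu>)
      = (\<integral>p. real (snd p) \<partial>distr M (count_space UNIV) ?Z)"
    using iid by (simp add: iid_def)
  also have "\<dots> = (\<integral>\<omega>. real (D k \<omega>) \<partial>M)"
    using integral_distr[OF Z, of "\<lambda>p. real (snd p)"] by simp
  finally show ?thesis by (simp add: secret_rate_def)
qed

theorem theorem2:
  fixes M :: "'w measure"
    and \<mu> :: "'a::countable pmf"
    and n :: nat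
    and s :: "'a list set \<Rightarrow> nat \<Rightarrow> 'a list"
    and x :: "nat \<Rightarrow> 'w \<Rightarrow> 'a"
    and y :: "nat \<Rightarrow> 'w \<Rightarrow> bool"
    and D :: "nat \<Rightarrow> 'w \<Rightarrow> nat"
  assumes "prob_space M"
    and "n > 1"
    and "\<And>u. length u = n \<Longrightarrow>
           bij_betw (s (same_counts u)) {..<card (same_counts u)} (same_counts u)"
    and "iid M x \<mu>"
    and "iid M y (pmf_of_set UNIV)"
    and "indep_sequences M x y"
    and "block_choices M n x y D"
  shows "iid M (\<lambda>j \<omega>. stego_out s n (\<lambda>i. x i \<omega>) (\<lambda>i. y i \<omega>) (\<lambda>k. D k \<omega>) j) \<mu> \<and>
         (\<forall>k. secret_rate M n D k \<ge>
           1 / real n *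
           ((\<Sum>\<^sub>\<infinity>u \<in> {u. length u = n}. (\<Prod>j<n. pmf \<mu> (u ! j)) *
               log 2 (fact n / (\<Prod>a\<in>set u. fact (count_list u a)))) - 2))"
proof (intro conjI allI)
  show "iid M (\<lambda>j \<omega>. stego_out s n (\<lambda>i. x i \<omega>) (\<lambda>i. y i \<omega>) (\<lambda>k. D k \<omega>) j) \<mu>"
    using assms by (intro iid_stego_out) auto
next
  fix k
  show "secret_rate M n D k \<ge> 1 / real n *
      ((\<Sum>\<^sub>\<infinity>u \<in> {u. length u = n}. (\<Prod>j<n. pmf \<mu> (u ! j)) *
          log 2 (fact n / (\<Prod>a\<in>set u. fact (count_list u a)))) - 2)"
    using divide_right_mono[OF expectation_block_choice_pmf_ge[of n \<mu>], of "real n"]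
    by (simp add: secret_rate_eq[OF assms(1,4,7)] expectation_log_card_eq_infsum)
qed

end
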